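(* Let $(X,d)$ be a locally compact metric space. Let $(\mu_\alpha)$ be a net in $\mathbf{DTM}(X)$ and $\mu\in\mathbf{DTM}(X)$, and suppose $d_{\mathrm{P}}(\mu_\alpha,\mu)\to 0$. Then $\mu_\alpha$ converges weakly to $\mu$.
   Context: $\mathcal{O}(X)$, $\mathcal{C}(X)$, $\mathcal{K}(X)$ are the collections of open, closed, compact subsets of $X$. A deficient topological measure on a locally compact Hausdorff space $X$ is a set function $\nu:\mathcal{C}(X)\cup\mathcal{O}(X)\to[0,\infty]$, not identically $\infty$, such that: (DTM1) $\nu(C\sqcup K)=\nu(C)+\nu(K)$ for disjoint $C,K\in\mathcal{K}(X)$; (DTM2) $\nu(U)=\sup\{\nu(C): C\subseteq U,\ C\in\mathcal{K}(X)\}$ for $U\in\mathcal{O}(X)$; (DTM3) $\nu(F)=\inf\{\nu(U): F\subseteq U,\ U\in\mathcal{O}(X)\}$ for $F\in\mathcal{C}(X)$. $\mathbf{DTM}(X)$ is the set of finite ($\nu(X)<\infty$) deficient topological measures. For nonempty $A\in\mathcal{O}(X)\cup\mathcal{C}(X)$ and $t>0$ let $A^t=\{x\in X: d(x,A)<t\}$, and $\emptyset^t=\emptyset$. The Prokhorov metric on $\mathbf{DTM}(X)$ is $$d_{\mathrm{P}}(\mu,\nu)=\inf\{t>0:\ \mu(A)\le\nu(A^t)+t,\ \nu(A)\le\mu(A^t)+t\ \ \forall A\in\mathcal{O}(X)\cup\mathcal{K}(X)\}.$$ $C_0^+(X)$ is the set of nonnegative continuous functions on $X$ vanishing at infinity.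 For $\mu\in\mathbf{DTM}(X)$ and $f\in C_0^+(X)$ with $f(X)\subseteq[0,b]$, $\int_X f\,d\mu=\int_0^b\mu(f^{-1}((t,\infty)))\,dt$. A net $\mu_\alpha$ in $\mathbf{DTM}(X)$ converges weakly to $\mu\in\mathbf{DTM}(X)$ if $\int_X f\,d\mu_\alpha\to\int_X f\,d\mu$ for every $f\in C_0^+(X)$. *)

theory Defs
  imports "HOL-Analysis.Analysis"
begin

section \<open>Deficient topological measures\<close>

text \<open>
  A set function on the open and closed sets is represented by a total function on
  \<^typ>\<open>'a set\<close>; all definitions below only consult its values on open and closed sets.
\<close>

definition deficient_topological_measure :: "('a::t2_space set \<Rightarrow> ennreal) \<Rightarrow> bool" where
  "deficient_topological_measure \<nu> \<longleftrightarrow>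
     (\<exists>A. (closed A \<or> open A) \<and> \<nu> A \<noteq> \<infinity>) \<and>
     (\<forall>C K. compact C \<and> compact K \<and> C \<inter> K = {} \<longrightarrow> \<nu> (C \<union> K) = \<nu> C + \<nu> K) \<and>
     (\<forall>U. open U \<longrightarrow> \<nu> U = (SUP C\<in>{C. C \<subseteq> U \<and> compact C}. \<nu> C)) \<and>
     (\<forall>F. closed F \<longrightarrow> \<nu> F = (INF U\<in>{U. F \<subseteq> U \<and> open U}. \<nu> U))"

definition DTM :: "('a::t2_space set \<Rightarrow> ennreal) set" where
  "DTM = {\<nu>. deficient_topological_measure \<nu> \<and> \<nu> UNIV < \<infinity>}"

lemma DTM_le_UNIV:
  assumes "\<nu> \<in> DTM" "open A \<or> closed A"
  shows "\<nu> A \<le> \<nu> UNIV"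
  using assms(2)
proof
  assume "open A"
  then have "\<nu> A = (SUP C\<in>{C. C \<subseteq> A \<and> compact C}. \<nu> C)"
    using assms(1) by (simp add: DTM_def deficient_topological_measure_def)
  also have "\<dots> \<le> (SUP C\<in>{C. C \<subseteq> UNIV \<and> compact C}. \<nu> C)"
    by (rule SUP_subset_mono) auto
  also have "\<dots> = \<nu> UNIV"
  proof -
    have "\<forall>U. open U \<longrightarrow> \<nu> U = (SUP C\<in>{C. C \<subseteq> U \<and> compact C}. \<nu> C)"
      using assms(1) by (simp add: DTM_def deficient_topological_measure_def)
    from this[rule_format, OF open_UNIV] show ?thesis by (rule sym)
  qed
  finally show ?thesis .
next
  assume "closed A"
  then have "\<nu> A = (INF U\<in>{U. A \<subseteq> U \<and> open U}. \<nu> U)"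
    using assms(1) by (simp add: DTM_def deficient_topological_measure_def)
  also have "\<dots> \<le> \<nu> UNIV" by (rule INF_lower) auto
  finally show ?thesis .
qed

lemma DTM_empty:
  assumes "\<nu> \<in> DTM"
  shows "\<nu> {} = 0"
proof -
  have "\<forall>C K. compact C \<and> compact K \<and> C \<inter> K = {} \<longrightarrow> \<nu> (C \<union> K) = \<nu> C + \<nu> K"
    using assms by (simp add: DTM_def deficient_topological_measure_def)
  from this[rule_format, of "{}" "{}"] have "\<nu> ({} \<union> {}) = \<nu> {} + \<nu> {}" by simp
  then have "\<nu> {} + 0 = \<nu> {} + \<nu> {}" by simp
  moreover have "\<nu> {} \<noteq> \<infinity>"
    using DTM_le_UNIV[OF assms, of "{}"] assms
    by (auto simp: DTM_def top_unique)
  ultimately show ?thesis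
    by (metis ennreal_add_left_cancel infinity_ennreal_def)
qed


section \<open>The Prokhorov metric\<close>

text \<open>The case split is needed because \<^term>\<open>infdist x {} = 0\<close> in the library.\<close>

definition enlargement :: "'a::metric_space set \<Rightarrow> real \<Rightarrow> 'a set" where
  "enlargement A t = (if A = {} then {} else {x. infdist x A < t})"

definition prokhorov_set ::
  "('a::metric_space set \<Rightarrow> ennreal) \<Rightarrow> ('a set \<Rightarrow> ennreal) \<Rightarrow> real set" where
  "prokhorov_set \<mu> \<nu> = {t. t > 0 \<and> (\<forall>A. open A \<or> compact A \<longrightarrow>
       \<mu> A \<le> \<nu> (enlargement A t) + ennreal t \<and> \<nu> A \<le> \<mu> (enlargement A t) + ennreal t)}"

definition prokhorov_dist ::
  "('a::metric_space set \<Rightarrow> ennreal) \<Rightarrow> ('a set \<Rightarrow> ennreal) \<Rightarrow> real" where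
  "prokhorov_dist \<mu> \<nu> = Inf (prokhorov_set \<mu> \<nu>)"

text \<open>On \<^const>\<open>DTM\<close> the real-valued infimum is a genuine one.\<close>

lemma prokhorov_set_nonempty:
  assumes "\<mu> \<in> DTM" "\<nu> \<in> DTM"
  shows "prokhorov_set \<mu> \<nu> \<noteq> {}"
proof -
  define t where "t = enn2real (\<mu> UNIV) + enn2real (\<nu> UNIV) + 1"
  have t: "t > 0" by (simp add: t_def add_nonneg_pos)
  have fin: "\<mu> UNIV < top" "\<nu> UNIV < top" using assms by (auto simp: DTM_def)
  have "\<mu> UNIV = ennreal (enn2real (\<mu> UNIV))" using fin by simp
  also have "\<dots> \<le> ennreal t" by (rule ennreal_leI) (simp add: t_def)
  finally have 1: "\<mu> UNIV \<le> ennreal t" .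
  have "\<nu> UNIV = ennreal (enn2real (\<nu> UNIV))" using fin by simp
  also have "\<dots> \<le> ennreal t" by (rule ennreal_leI) (simp add: t_def)
  finally have 2: "\<nu> UNIV \<le> ennreal t" .
  have "\<mu> A \<le> ennreal t" "\<nu> A \<le> ennreal t" if "open A \<or> compact A" for A
  proof -
    have "open A \<or> closed A" using that compact_imp_closed by blast
    then show "\<mu> A \<le> ennreal t" "\<nu> A \<le> ennreal t"
      using DTM_le_UNIV[OF assms(1), of A] DTM_le_UNIV[OF assms(2), of A] 1 2
      by (simp_all add: order_trans)
  qed
  then have "t \<in> prokhorov_set \<mu> \<nu>"
    using t unfolding prokhorov_set_def by (simp add: add_increasing)
  then show ?thesis by blast
qed

lemma prokhorov_set_bdd_below: "bdd_below (prokhorov_set \<mu> \<nu>)"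
  unfolding prokhorov_set_def by (rule bdd_belowI[of _ 0]) auto


section \<open>Integration and weak convergence\<close>

definition C0_plus :: "('a::topological_space \<Rightarrow> real) set" where
  "C0_plus = {f. continuous_on UNIV f \<and> (\<forall>x. 0 \<le> f x) \<and>
                 (\<forall>e>0. \<exists>K. compact K \<and> (\<forall>x. x \<notin> K \<longrightarrow> \<bar>f x\<bar> < e))}"

text \<open>
  The upper limit of integration is the least admissible one; by
  \<open>dtm_integral_eq\<close> below any \<open>b\<close> with \<open>f(X) \<subseteq> [0, b]\<close> gives the same value.
\<close>

definition dtm_integral :: "('a::topological_space set \<Rightarrow> ennreal) \<Rightarrow> ('a \<Rightarrow> real) \<Rightarrow> ennreal" where
  "dtm_integral \<mu> f = (\<integral>\<^sup>+ t\<in>{0..(SUP x. f x)}. \<mu> (f -` {t<..}) \<partial>lborel)"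

lemma dtm_integral_eq:
  assumes "\<mu> \<in> DTM" and "range f \<subseteq> {0..b}"
  shows "dtm_integral \<mu> f = (\<integral>\<^sup>+ t\<in>{0..b}. \<mu> (f -` {t<..}) \<partial>lborel)"
proof -
  have bdd: "bdd_above (range f)" using assms(2) by (meson bdd_above_Icc bdd_above_mono)
  have le: "(SUP x. f x) \<le> b" by (rule cSUP_least) (use assms(2) in \<open>auto simp: image_subset_iff\<close>)
  have "\<mu> (f -` {t<..}) = 0" if "t > (SUP x. f x)" for t
  proof -
    have "\<forall>x. \<not> t < f x"
      using cSUP_upper[OF UNIV_I bdd] that by (meson not_less order_less_imp_le order_trans)
    then have "f -` {t<..} = {}" by auto
    then show ?thesis using DTM_empty[OF assms(1)] by simp
  qed
  then show ?thesis unfolding dtm_integral_def using le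
    by (intro nn_integral_cong) (force simp: indicator_def not_le)
qed

lemma C0_plus_bounded:
  assumes "f \<in> C0_plus"
  shows "\<exists>b. range f \<subseteq> {0..b}"
proof -
  obtain K where K: "compact K" "\<And>x. x \<notin> K \<Longrightarrow> \<bar>f x\<bar> < 1"
    using assms unfolding C0_plus_def by (auto dest: spec[of _ 1])
  have "compact (f ` K)"
    using assms K(1) unfolding C0_plus_def
    by (auto intro: compact_continuous_image continuous_on_subset)
  then obtain c where c: "\<And>x. x \<in> K \<Longrightarrow> \<bar>f x\<bar> \<le> c"
    by (meson bounded_real compact_imp_bounded imageI)
  have "f x \<in> {0..max c 1}" for x
    using assms c[of x] K(2)[of x] by (cases "x \<in> K") (auto simp: C0_plus_def)
  then show ?thesis by blast
qed

text \<open>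
  Nets are families indexed by a directed set \<open>(I, le)\<close>; convergence of a net is
  convergence along the filter generated by its tails.
\<close>

definition directed_set :: "'i set \<Rightarrow> ('i \<Rightarrow> 'i \<Rightarrow> bool) \<Rightarrow> bool" where
  "directed_set I le \<longleftrightarrow> I \<noteq> {} \<and> reflp_on I le \<and> transp_on I le \<and>
     (\<forall>i\<in>I. \<forall>j\<in>I. \<exists>k\<in>I. le i k \<and> le j k)"

definition tail_filter :: "'i set \<Rightarrow> ('i \<Rightarrow> 'i \<Rightarrow> bool) \<Rightarrow> 'i filter" where
  "tail_filter I le = (INF i\<in>I. principal {j\<in>I. le i j})"

lemma eventually_tail_filter:
  assumes "directed_set I le"
  shows "eventually P (tail_filter I le) \<longleftrightarrow> (\<exists>i\<in>I. \<forall>j\<in>I. le i j \<longrightarrow> P j)"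
proof -
  have "\<exists>k\<in>I. principal {l\<in>I. le k l} \<le> inf (principal {l\<in>I. le i l}) (principal {l\<in>I. le j l})"
    if ij: "i \<in> I" "j \<in> I" for i j
  proof -
    obtain k where k: "k \<in> I" "le i k" "le j k"
      using assms ij unfolding directed_set_def by blast
    have "transp_on I le" using assms by (simp add: directed_set_def)
    then have "{l\<in>I. le k l} \<subseteq> {l\<in>I. le i l} \<inter> {l\<in>I. le j l}"
      using k ij by (auto dest: transp_onD)
    then show ?thesis using k(1) by auto
  qed
  moreover have "I \<noteq> {}" using assms by (simp add: directed_set_def)
  ultimately show ?thesis
    unfolding tail_filter_def by (subst eventually_INF_base) (auto simp: eventually_principal)
qed

definition weakly_converges ::
  "('i \<Rightarrow> 'a::topological_space set \<Rightarrow> ennreal) \<Rightarrow> ('a set \<Rightarrow> ennreal) \<Rightarrow> 'i filter \<Rightarrow> bool" where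
  "weakly_converges \<mu>s \<mu> F \<longleftrightarrow>
     (\<forall>f\<in>C0_plus. ((\<lambda>\<alpha>. dtm_integral (\<mu>s \<alpha>) f) \<longlongrightarrow> dtm_integral \<mu> f) F)"

end

theory Submission
  imports Defs
begin

text \<open>
  A Prokhorov bound compares \<open>\<mu>\<close> on a set with \<open>\<nu>\<close> on a slightly enlarged set. A
  function \<open>f\<close> vanishing at infinity is uniformly continuous, so enlarging a superlevel set
  \<open>{f > s}\<close> by a small \<open>t\<close> stays inside \<open>{f > s - e}\<close>. Hence the two distribution functions
  satisfy \<open>\<mu> {f > s} \<le> \<nu> {f > s - e} + e\<close>, as in the definition of the Levy metric on the
  line. Integrating in \<open>s\<close> over \<open>[0, b]\<close>, the shift by \<open>e\<close> costs at most \<open>e * \<nu> UNIV\<close> because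
  distribution functions are bounded by the total mass, and the additive error costs \<open>e * b\<close>.
  The Prokhorov bound is symmetric, and it also bounds the total masses of the net by
  \<open>\<mu> UNIV + e\<close>, so the integrals differ by a bounded multiple of \<open>e\<close>.
\<close>

lemma DTM_mono_open:
  assumes "\<nu> \<in> DTM" "open U" "open V" "U \<subseteq> V"
  shows "\<nu> U \<le> \<nu> V"
proof -
  have inner: "\<nu> W = (SUP C\<in>{C. C \<subseteq> W \<and> compact C}. \<nu> C)" if "open W" for W
    using assms(1) that by (simp add: DTM_def deficient_topological_measure_def)
  show ?thesis
    unfolding inner[OF assms(2)] inner[OF assms(3)]
    by (rule SUP_subset_mono) (use assms(4) in auto)
qed

lemma DTM_distribution_measurable:
  fixes f :: "'a::t2_space \<Rightarrow> real"
  assumes "\<nu> \<in> DTM" "continuous_on UNIV f"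
  shows "(\<lambda>s. \<nu> (f -` {s<..})) \<in> borel_measurable borel"
proof -
  have op: "open (f -` {s<..})" for s
    using assms(2) by (intro open_vimage) auto
  have anti: "\<nu> (f -` {s<..}) \<le> \<nu> (f -` {r<..})" if "r \<le> s" for r s
    by (rule DTM_mono_open[OF assms(1) op op]) (use that in auto)
  show ?thesis
  proof (rule borel_measurableI_greater)
    fix y :: ennreal
    \<comment> \<open>The distribution function is antitone, so its strict superlevel sets are intervals.\<close>
    have "is_interval {s. y < \<nu> (f -` {s<..})}"
      unfolding is_interval_1 by (auto intro: less_le_trans anti)
    then have "{s. y < \<nu> (f -` {s<..})} \<in> sets borel"
      by (rule real_interval_borel_measurable)
    then show "{s \<in> space borel. y < \<nu> (f -` {s<..})} \<in> sets borel" by simp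
  qed
qed

text \<open>
  Outside a compact set \<open>K\<close> the values of \<open>f\<close> lie in \<open>[0, e)\<close>, so two points far out need no
  argument. If one of the points lies in \<open>K\<close>, a Lebesgue number of a cover of \<open>K\<close> by open sets
  on which \<open>f\<close> oscillates by less than \<open>e\<close> controls the other point as well.
\<close>

lemma C0_plus_uniformly_continuous:
  fixes f :: "'a::metric_space \<Rightarrow> real"
  assumes f: "f \<in> C0_plus" and e: "e > 0"
  shows "\<exists>d>0. \<forall>x y. dist x y < d \<longrightarrow> \<bar>f x - f y\<bar> < e"
proof -
  have cont: "continuous_on UNIV f" and nonneg: "\<And>x. 0 \<le> f x"
    using f by (auto simp: C0_plus_def)
  obtain K where K: "compact K" and small: "\<And>x. x \<notin> K \<Longrightarrow> \<bar>f x\<bar> < e"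
    using f e unfolding C0_plus_def by blast
  define G where "G = range (\<lambda>c. f -` ball c (e/2))"
  have "x \<in> f -` ball (f x) (e/2)" for x using e by simp
  then have "K \<subseteq> \<Union>G" unfolding G_def by blast
  moreover have "open B" if "B \<in> G" for B
    using that cont by (auto simp: G_def intro!: open_vimage)
  ultimately obtain d where d: "d > 0" "\<And>x. x \<in> K \<Longrightarrow> \<exists>B\<in>G. ball x d \<subseteq> B"
    using Heine_Borel_lemma[OF K, of G] by metis
  have near: "\<bar>f x - f y\<bar> < e" if xy: "x \<in> K" "dist x y < d" for x y
  proof -
    obtain c where "ball x d \<subseteq> f -` ball c (e/2)"
      using d(2)[OF xy(1)] by (auto simp: G_def)
    moreover have "x \<in> ball x d" "y \<in> ball x d" using xy d(1) by auto
    ultimately have "x \<in> f -` ball c (e/2)" "y \<in> f -` ball c (e/2)" by (meson subsetD)+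
    then have "dist c (f x) < e/2" "dist c (f y) < e/2" by simp_all
    then show ?thesis unfolding dist_real_def by linarith
  qed
  have "\<bar>f x - f y\<bar> < e" if "dist x y < d" for x y
  proof -
    consider "x \<in> K" | "y \<in> K" | "x \<notin> K" "y \<notin> K" by blast
    then show ?thesis
    proof cases
      case 1 then show ?thesis using near that by blast
    next
      case 2 then show ?thesis using near[of y x] that by (simp add: dist_commute abs_minus_commute)
    next
      case 3 then show ?thesis using small[of x] small[of y] nonneg[of x] nonneg[of y] by linarith
    qed
  qed
  then show ?thesis using d(1) by blast
qed

lemma enlargement_superlevel_subset:
  fixes f :: "'a::metric_space \<Rightarrow> real"
  assumes "\<And>x y. dist x y < d \<Longrightarrow> \<bar>f x - f y\<bar> < e" "t \<le> d"
  shows "enlargement (f -` {s<..}) t \<subseteq> f -` {s - e<..}"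
proof
  fix x assume x: "x \<in> enlargement (f -` {s<..}) t"
  then have ne: "f -` {s<..} \<noteq> {}" and "infdist x (f -` {s<..}) < t"
    by (auto simp: enlargement_def split: if_splits)
  then have "(INF y\<in>f -` {s<..}. dist x y) < t" by (simp add: infdist_def)
  then obtain y where "s < f y" "dist x y < t"
    using cInf_lessD[of "dist x ` (f -` {s<..})" t] ne by auto
  then show "x \<in> f -` {s - e<..}" using assms(1)[of x y] assms(2) by auto
qed

lemma open_enlargement: "open (enlargement A t)"
  by (auto simp: enlargement_def intro!: open_Collect_less continuous_intros)

lemma prokhorov_set_superlevel_le:
  fixes f :: "'a::metric_space \<Rightarrow> real"
  assumes "\<nu> \<in> DTM" "t \<in> prokhorov_set \<mu> \<nu>" "continuous_on UNIV f"
    and "\<And>x y. dist x y < d \<Longrightarrow> \<bar>f x - f y\<bar> < e" "t \<le> d" "t \<le> e"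
  shows "\<mu> (f -` {s<..}) \<le> \<nu> (f -` {s - e<..}) + ennreal e"
proof -
  have op: "open (f -` {r<..})" for r
    using assms(3) by (intro open_vimage) auto
  have "\<mu> (f -` {s<..}) \<le> \<nu> (enlargement (f -` {s<..}) t) + ennreal t"
    using assms(2) op by (auto simp: prokhorov_set_def)
  also have "\<dots> \<le> \<nu> (f -` {s - e<..}) + ennreal e"
    using assms(6)
    by (intro add_mono DTM_mono_open[OF assms(1) open_enlargement op]
        enlargement_superlevel_subset[OF assms(4,5)] ennreal_leI) auto
  finally show ?thesis .
qed

lemma prokhorov_set_commute: "prokhorov_set \<mu> \<nu> = prokhorov_set \<nu> \<mu>"
  by (auto simp: prokhorov_set_def)

text \<open>
  Substituting \<open>s + e\<close> for \<open>s\<close> turns the shifted distribution function into the original one on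
  \<open>[-e, b - e]\<close>; the part over \<open>[-e, 0]\<close> is where the total mass enters.
\<close>

lemma dtm_integral_le_of_shift:
  fixes f :: "'a::t2_space \<Rightarrow> real"
  assumes \<mu>: "\<mu> \<in> DTM" and \<nu>: "\<nu> \<in> DTM" and cont: "continuous_on UNIV f"
    and range: "range f \<subseteq> {0..b}" and e: "e > 0"
    and le: "\<And>s. \<mu> (f -` {s<..}) \<le> \<nu> (f -` {s - e<..}) + ennreal e"
  shows "dtm_integral \<mu> f \<le> dtm_integral \<nu> f + \<nu> UNIV * ennreal e + ennreal (e * b)"
proof -
  have b: "0 \<le> b" using range by (metis UNIV_I atLeastAtMost_iff image_subset_iff order_trans)
  note [measurable] = DTM_distribution_measurable[OF \<nu> cont]
  let ?g = "\<lambda>s. \<nu> (f -` {s<..})"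
  have bound: "?g s \<le> \<nu> UNIV" for s
    using cont by (intro DTM_le_UNIV[OF \<nu>] disjI1 open_vimage) auto
  have "dtm_integral \<mu> f \<le> (\<integral>\<^sup>+ s. (?g (s - e) + ennreal e) * indicator {0..b} s \<partial>lborel)"
    unfolding dtm_integral_eq[OF \<mu> range]
    by (intro nn_integral_mono mult_right_mono le) simp
  also have "\<dots> = (\<integral>\<^sup>+ s. ?g (s - e) * indicator {0..b} s \<partial>lborel)
      + (\<integral>\<^sup>+ s. ennreal e * indicator {0..b} s \<partial>lborel)"
    unfolding distrib_right by (rule nn_integral_add) measurable
  also have "(\<integral>\<^sup>+ s. ennreal e * indicator {0..b} s \<partial>lborel) = ennreal (e * b)"
    using b e by (simp add: nn_integral_cmult_indicator ennreal_mult)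
  also have "(\<integral>\<^sup>+ s. ?g (s - e) * indicator {0..b} s \<partial>lborel)
      = (\<integral>\<^sup>+ s. ?g s * indicator {0..b} (e + s) \<partial>lborel)"
    using nn_integral_real_affine[of "\<lambda>s. ?g (s - e) * indicator {0..b} s" 1 e] by simp
  also have "\<dots> \<le> (\<integral>\<^sup>+ s. ?g s * indicator {0..b} s + \<nu> UNIV * indicator {-e..0} s \<partial>lborel)"
    using bound e by (intro nn_integral_mono) (auto simp: indicator_def)
  also have "\<dots> = dtm_integral \<nu> f + \<nu> UNIV * ennreal e"
    unfolding dtm_integral_eq[OF \<nu> range] using e
    by (subst nn_integral_add) (auto simp: nn_integral_cmult_indicator)
  finally show ?thesis by (simp add: add_right_mono)
qed

lemma dtm_integral_finite:
  assumes "\<mu> \<in> DTM" "continuous_on UNIV f" "range f \<subseteq> {0..b}"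
  shows "dtm_integral \<mu> f < \<infinity>"
proof -
  have "\<mu> (f -` {s<..}) \<le> \<mu> UNIV" for s
    using assms(2) by (intro DTM_le_UNIV[OF assms(1)] disjI1 open_vimage) auto
  then have "dtm_integral \<mu> f \<le> (\<integral>\<^sup>+ s. \<mu> UNIV * indicator {0..b} s \<partial>lborel)"
    unfolding dtm_integral_eq[OF assms(1,3)] by (intro nn_integral_mono mult_right_mono) auto
  also have "\<dots> < \<infinity>"
    using assms(1)
    by (auto simp: nn_integral_cmult_indicator DTM_def ennreal_mult_less_top emeasure_lborel_Icc_eq)
  finally show ?thesis .
qed

lemma tendsto_ennreal_of_eventually_near:
  fixes c :: ennreal
  assumes c: "c < \<infinity>"
    and near: "\<And>e. e > 0 \<Longrightarrow> eventually (\<lambda>\<alpha>. X \<alpha> \<le> c + ennreal e \<and> c \<le> X \<alpha> + ennreal e) F"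
  shows "(X \<longlongrightarrow> c) F"
proof -
  have lim: "((\<lambda>\<alpha>. enn2real (X \<alpha>)) \<longlongrightarrow> enn2real c) F"
  proof (rule tendstoI)
    fix e :: real assume e: "e > 0"
    show "eventually (\<lambda>\<alpha>. dist (enn2real (X \<alpha>)) (enn2real c) < e) F"
      using near[of "e/2"]
    proof (rule eventually_mono)
      fix \<alpha> assume *: "X \<alpha> \<le> c + ennreal (e/2) \<and> c \<le> X \<alpha> + ennreal (e/2)"
      then have "X \<alpha> < \<infinity>" using c by (auto simp: le_less_trans)
      then show "dist (enn2real (X \<alpha>)) (enn2real c) < e"
        using * c e
        by (cases "X \<alpha>"; cases c) (auto simp: dist_real_def simp flip: ennreal_plus)
    qed (use e in simp)
  qed
  have "eventually (\<lambda>\<alpha>. ennreal (enn2real (X \<alpha>)) = X \<alpha>) F"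
    using near[of 1] by (rule eventually_mono) (use c in \<open>auto simp: le_less_trans\<close>)
  then show ?thesis
    using tendsto_ennrealI[OF lim] c by (simp add: tendsto_cong)
qed

theorem theorem38:
  fixes I :: "'i set" and le :: "'i \<Rightarrow> 'i \<Rightarrow> bool"
    and \<mu>s :: "'i \<Rightarrow> 'a::metric_space set \<Rightarrow> ennreal" and \<mu> :: "'a set \<Rightarrow> ennreal"
  assumes "locally compact (UNIV :: 'a set)"
    and "directed_set I le"
    and "\<And>\<alpha>. \<alpha> \<in> I \<Longrightarrow> \<mu>s \<alpha> \<in> DTM"
    and "\<mu> \<in> DTM"
    and "((\<lambda>\<alpha>. prokhorov_dist (\<mu>s \<alpha>) \<mu>) \<longlongrightarrow> 0) (tail_filter I le)"
  shows "weakly_converges \<mu>s \<mu> (tail_filter I le)"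
  unfolding weakly_converges_def
proof
  fix f :: "'a \<Rightarrow> real" assume f: "f \<in> C0_plus"
  then have cont: "continuous_on UNIV f" by (simp add: C0_plus_def)
  obtain b where b: "range f \<subseteq> {0..b}" using C0_plus_bounded[OF f] by blast
  then have b0: "0 \<le> b" by (metis UNIV_I atLeastAtMost_iff image_subset_iff order_trans)
  have \<mu>: "\<mu> \<in> DTM" by fact
  define M where "M = enn2real (\<mu> UNIV)"
  have M: "\<mu> UNIV = ennreal M" "M \<ge> 0" using \<mu> by (auto simp: M_def DTM_def)
  have inI: "eventually (\<lambda>\<alpha>. \<alpha> \<in> I) (tail_filter I le)"
    using assms(2) by (auto simp: eventually_tail_filter directed_set_def)
  show "((\<lambda>\<alpha>. dtm_integral (\<mu>s \<alpha>) f) \<longlongrightarrow> dtm_integral \<mu> f) (tail_filter I le)"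
  proof (rule tendsto_ennreal_of_eventually_near)
    show "dtm_integral \<mu> f < \<infinity>" by (rule dtm_integral_finite[OF \<mu> cont b])
  next
    fix r :: real assume r: "r > 0"
    \<comment> \<open>The bound \<open>e \<le> 1\<close> keeps the total masses of the net below \<open>M + 1\<close>, so \<open>M + 1 + b\<close> is the
      factor of \<open>e\<close> in the error.\<close>
    define e where "e = min 1 (r / (M + 1 + b))"
    have e: "0 < e" "e \<le> 1" "e * (M + 1 + b) \<le> r"
    proof -
    have pos: "0 < M + 1 + b" using M(2) b0 by simp
    then show "0 < e" "e \<le> 1" using r by (simp_all add: e_def)
    have "e \<le> r / (M + 1 + b)" by (simp add: e_def)
    then show "e * (M + 1 + b) \<le> r" using pos by (simp add: pos_le_divide_eq)
  qed
    obtain d where d: "d > 0" "\<And>x y. dist x y < d \<Longrightarrow> \<bar>f x - f y\<bar> < e"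
      using C0_plus_uniformly_continuous[OF f e(1)] by blast
    have "eventually (\<lambda>\<alpha>. prokhorov_dist (\<mu>s \<alpha>) \<mu> < min d e) (tail_filter I le)"
      using order_tendstoD(2)[OF assms(5), of "min d e"] d(1) e(1) by simp
    with inI show "eventually (\<lambda>\<alpha>. dtm_integral (\<mu>s \<alpha>) f \<le> dtm_integral \<mu> f + ennreal r \<and>
        dtm_integral \<mu> f \<le> dtm_integral (\<mu>s \<alpha>) f + ennreal r) (tail_filter I le)"
    proof eventually_elim
      case (elim \<alpha>)
      have \<mu>\<alpha>: "\<mu>s \<alpha> \<in> DTM" using assms(3) elim(1) .
      obtain t where t: "t \<in> prokhorov_set (\<mu>s \<alpha>) \<mu>" "t \<le> d" "t \<le> e"
        using cInf_lessD[OF prokhorov_set_nonempty[OF \<mu>\<alpha> \<mu>]] elim(2)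
        unfolding prokhorov_dist_def by fastforce
      note t' = t(1)[unfolded prokhorov_set_commute[of "\<mu>s \<alpha>"]]
      have "\<mu>s \<alpha> UNIV \<le> \<mu> (enlargement UNIV t) + ennreal t"
        using t(1) by (simp add: prokhorov_set_def)
      also have "\<dots> \<le> \<mu> UNIV + ennreal 1"
        using t(3) e(2) by (intro add_mono DTM_le_UNIV[OF \<mu>] disjI1 open_enlargement ennreal_leI) auto
      also have "\<dots> = ennreal (M + 1)" using M by (subst ennreal_plus) auto
      finally have mass\<alpha>: "\<mu>s \<alpha> UNIV \<le> ennreal (M + 1)" .
      have mass: "\<mu> UNIV \<le> ennreal (M + 1)" using M by (simp add: ennreal_leI)
      have error: "m * ennreal e + ennreal (e * b) \<le> ennreal r" if "m \<le> ennreal (M + 1)" for m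
      proof -
        have "m * ennreal e + ennreal (e * b) \<le> ennreal (M + 1) * ennreal e + ennreal (e * b)"
          using that by (intro add_right_mono mult_right_mono) auto
        also have "\<dots> = ennreal (e * (M + 1 + b))"
          using M(2) e(1) b0 by (simp add: algebra_simps flip: ennreal_mult ennreal_plus)
        also have "\<dots> \<le> ennreal r" using e(3) by (rule ennreal_leI)
        finally show ?thesis .
      qed
      have "dtm_integral (\<mu>s \<alpha>) f \<le> dtm_integral \<mu> f + (\<mu> UNIV * ennreal e + ennreal (e * b))"
        using dtm_integral_le_of_shift[OF \<mu>\<alpha> \<mu> cont b e(1)
            prokhorov_set_superlevel_le[OF \<mu> t(1) cont d(2) t(2,3)]]
        by (simp add: add.assoc)
      moreover have "dtm_integral \<mu> f
          \<le> dtm_integral (\<mu>s \<alpha>) f + (\<mu>s \<alpha> UNIV * ennreal e + ennreal (e * b))"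
        using dtm_integral_le_of_shift[OF \<mu> \<mu>\<alpha> cont b e(1)
            prokhorov_set_superlevel_le[OF \<mu>\<alpha> t' cont d(2) t(2,3)]]
        by (simp add: add.assoc)
      ultimately show ?case
        using error[OF mass] error[OF mass\<alpha>] by (meson add_left_mono order_trans)
    qed
  qed
qed

end
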